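(* For all integers $n \geq k$, the score of the Prolonger-may-pass $P_k$-saturation game on $K_n$ satisfies \[\tfrac{1}{4}n(k-2) \leq \mathcal{G}_{-P}(K_n; P_k) \leq \tfrac{1}{2}n(k-1).\]
   Context: $P_k$ denotes the path on $k$ vertices. For a family $\mathcal{F}$ of graphs, a graph is $\mathcal{F}$-free if it contains no member of $\mathcal{F}$ as a subgraph; a subgraph $G \subseteq H$ is $\mathcal{F}$-saturated in $H$ if it is a maximal $\mathcal{F}$-free subgraph of $H$ (no edge of $H$ not in $G$ can be added while keeping it $\mathcal{F}$-free). The $\mathcal{F}$-saturation game on $H$ ($|V(H)|=n$): two players, Prolonger and Shortener, alternately build a graph process starting from the empty graph on $V(H)$; on each turn the player to move adds one edge of $H$ not yet present such that the graph remains $\mathcal{F}$-free; the game ends when the current graph is $\mathcal{F}$-saturated in $H$. Prolonger wants to maximise and Shortener to minimise the number of edges of the final graph (the score); the score under optimal play is the game saturation number. The variant $\mathcal{G}_{-P}(H;\mathcal{F})$ is the same game except that on his turn Prolonger may decline to add any edge (leaving the graph unchanged), while Shortener must still add an edge on each of her turns; its score is again the number of edges of the final $\mathcal{F}$-saturated graph under optimal play. The stated bounds hold regardless of which player moves first. Here $\mathcal{G}_{-P}(K_n;P_k)$ denotes this variant with $H = K_n$ and $\mathcal{F} = \{P_k\}$. *)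

theory Defs
  imports Complex_Main
begin

type_synonym 'a graph = "'a set \<times> 'a set set"

abbreviation verts :: "'a graph \<Rightarrow> 'a set" where
  "verts \<equiv> fst"

abbreviation edges :: "'a graph \<Rightarrow> 'a set set" where
  "edges \<equiv> snd"

definition complete_graph :: "nat \<Rightarrow> nat graph" where
  "complete_graph n = ({..<n}, {{u, v} |u v. u < n \<and> v < n \<and> u \<noteq> v})"

text \<open>The number \<open>k\<close> counts the vertices of the path, not its edges.\<close>

definition path_graph :: "nat \<Rightarrow> nat graph" where
  "path_graph k = ({..<k}, {{i, Suc i} |i. Suc i < k})"

text \<open>Containment as a (not necessarily induced) subgraph, up to isomorphism.\<close>

definition contains_copy :: "'a graph \<Rightarrow> 'b graph \<Rightarrow> bool" where
  "contains_copy G F \<longleftrightarrow>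
     (\<exists>f. inj_on f (verts F) \<and> f ` verts F \<subseteq> verts G \<and> (\<forall>e\<in>edges F. f ` e \<in> edges G))"

definition family_free :: "'b graph set \<Rightarrow> 'a graph \<Rightarrow> bool" where
  "family_free \<F> G \<longleftrightarrow> (\<forall>F\<in>\<F>. \<not> contains_copy G F)"

text \<open>
  All graphs arising in the game on \<open>H\<close> are spanning subgraphs of \<open>H\<close>, so a position
  is given by its edge set \<open>E\<close>.
\<close>

definition saturated_in :: "'a graph \<Rightarrow> 'b graph set \<Rightarrow> 'a set set \<Rightarrow> bool" where
  "saturated_in H \<F> E \<longleftrightarrow>
     E \<subseteq> edges H \<and> family_free \<F> (verts H, E) \<and>
     (\<forall>e \<in> edges H - E. \<not> family_free \<F> (verts H, insert e E))"

definition legal_moves :: "'a graph \<Rightarrow> 'b graph set \<Rightarrow> 'a set set \<Rightarrow> 'a set set" where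
  "legal_moves H \<F> E = {e \<in> edges H - E. family_free \<F> (verts H, insert e E)}"

lemma legal_moves_empty_iff_saturated_in:
  assumes "E \<subseteq> edges H" "family_free \<F> (verts H, E)"
  shows "legal_moves H \<F> E = {} \<longleftrightarrow> saturated_in H \<F> E"
  using assms by (auto simp: legal_moves_def saturated_in_def)

datatype player = Prolonger | Shortener

text \<open>
  \<open>pass_value H \<F> p E\<close> is the minimax value of the position \<open>E\<close> with player \<open>p\<close> to move, where
  Prolonger (only) may also pass. Reachable positions are free of \<open>\<F>\<close> as soon as the
  empty graph is, so by the preceding lemma the game stops exactly at the saturated ones. The
  case of infinitely many edges is a dummy that makes the recursion well-founded.
\<close>

function pass_value :: "'a graph \<Rightarrow> 'b graph set \<Rightarrow> player \<Rightarrow> 'a set set \<Rightarrow> nat" where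
  "pass_value H \<F> p E =
     (if infinite (edges H) \<or> legal_moves H \<F> E = {} then card E
      else case p of
        Shortener \<Rightarrow> Min ((\<lambda>e. pass_value H \<F> Prolonger (insert e E)) ` legal_moves H \<F> E)
      | Prolonger \<Rightarrow> Max (insert (pass_value H \<F> Shortener E)
                         ((\<lambda>e. pass_value H \<F> Shortener (insert e E)) ` legal_moves H \<F> E)))"
  by pat_completeness auto

lemma card_legal_move_less:
  assumes "finite (edges H)" "e \<in> legal_moves H \<F> E"
  shows "card (edges H - insert e E) < card (edges H - E)"
  using assms by (intro psubset_card_mono) (auto simp: legal_moves_def)

termination
  by (relation "measures [\<lambda>(H, \<F>, p, E). card (edges H - E),
                          \<lambda>(H, \<F>, p, E). if p = Prolonger then 1 else 0]")
     (auto dest: card_legal_move_less)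

declare pass_value.simps [simp del]

text \<open>The score of the Prolonger-may-pass game when player \<open>p\<close> moves first.\<close>

definition pass_game_score :: "player \<Rightarrow> 'a graph \<Rightarrow> 'b graph set \<Rightarrow> nat" where
  "pass_game_score p H \<F> = pass_value H \<F> p {}"

end

theory Submission
  imports Defs "HOL-Library.Disjoint_Sets"
begin

text \<open>
  Upper bound: a weak form of the Erdos--Gallai theorem. Lower bound: Prolonger keeps every
  component Hamiltonian (or of order at most two) and of order less than \<open>k\<close>, passing whenever
  Shortener plays inside a component. In the final position the components are then cliques whose
  orders sum pairwise to at least \<open>k\<close>, and convexity gives average degree at least \<open>(k - 2) / 2\<close>.
\<close>

section \<open>Paths and cycles as lists\<close>

text \<open>Cycles are kept because a cycle can be opened at any prescribed vertex: wherever
  Shortener attaches a joining edge, the union gets a Hamiltonian path, so a legal joining move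
  cannot create a component of order \<open>k\<close> or more. Order below \<open>k\<close> in turn
  makes every edge inside a component legal for the rest of the game, which is why the final
  components are cliques. The invariant is required only when Shortener is to move. A Prolonger
  without the right to pass could be forced, once all components are complete, to join two of them
  himself and leave the union without a spanning cycle. The constant 1/4: at most one final clique
  has fewer than k/2 vertices. Together with any other clique, with orders a + b >= k, its average
  degree is (a^2 + b^2)/(a + b) - 1 >= k/2 - 1. The upper bound holds in every reachable position,
  so no strategy of Shortener enters.\<close>

definition gpath :: "'a set set \<Rightarrow> 'a list \<Rightarrow> bool" where
  "gpath E xs \<longleftrightarrow> distinct xs \<and> successively (\<lambda>u v. {u, v} \<in> E) xs"

text \<open>Lists of length one and two count as cycles; for two vertices the closing edge is the edge itself.\<close>

definition gcycle :: "'a set set \<Rightarrow> 'a list \<Rightarrow> bool" where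
  "gcycle E xs \<longleftrightarrow> gpath E xs \<and> xs \<noteq> [] \<and> (2 \<le> length xs \<longrightarrow> {last xs, hd xs} \<in> E)"

lemma gpath_append:
  "gpath E (xs @ ys) \<longleftrightarrow> gpath E xs \<and> gpath E ys \<and> set xs \<inter> set ys = {} \<and>
     (xs \<noteq> [] \<and> ys \<noteq> [] \<longrightarrow> {last xs, hd ys} \<in> E)"
  by (auto simp: gpath_def successively_append_iff)

lemma gpath_Cons:
  "gpath E (x # xs) \<longleftrightarrow> x \<notin> set xs \<and> gpath E xs \<and> (xs \<noteq> [] \<longrightarrow> {x, hd xs} \<in> E)"
  using gpath_append[of E "[x]" xs] by (auto simp: gpath_def)

lemma gpath_rev [simp]: "gpath E (rev xs) \<longleftrightarrow> gpath E xs"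
  by (simp add: gpath_def insert_commute)

lemma gpath_mono: "gpath E xs \<Longrightarrow> E \<subseteq> F \<Longrightarrow> gpath F xs"
  by (auto simp: gpath_def elim: successively_mono)

lemma gcycle_mono: "gcycle E xs \<Longrightarrow> E \<subseteq> F \<Longrightarrow> gcycle F xs"
  by (auto simp: gcycle_def intro: gpath_mono)

lemma gcycle_swap:
  assumes "gcycle E (xs @ ys)"
  shows "gcycle E (ys @ xs)"
proof (cases "xs = [] \<or> ys = []")
  case True
  then show ?thesis using assms by auto
next
  case False
  then have "2 \<le> length (xs @ ys)"
    by (cases xs; cases ys) auto
  then show ?thesis
    using assms False by (auto simp: gcycle_def gpath_append)
qed

text \<open>Any edge leaving the vertex set of a cycle extends some Hamiltonian path of that set.
  Both bounds rest on this freedom: in the upper bound such an edge would lengthen a longest path,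
  in the lower bound it links two components.\<close>

lemma gcycle_start_at:
  assumes "gcycle E xs" "x \<in> set xs"
  obtains ys where "gcycle E ys" "set ys = set xs" "length ys = length xs" "hd ys = x"
proof -
  obtain as bs where xs: "xs = as @ x # bs"
    using assms(2) by (meson split_list)
  have "gcycle E ((x # bs) @ as)"
    using assms(1) unfolding xs by (rule gcycle_swap)
  then show ?thesis
    by (rule that) (auto simp: xs)
qed

lemma gcycle_end_at:
  assumes "gcycle E xs" "x \<in> set xs"
  obtains ys where "gcycle E ys" "set ys = set xs" "length ys = length xs" "last ys = x"
proof -
  obtain as bs where xs: "xs = (as @ [x]) @ bs"
    using assms(2) by (metis append.assoc append_Cons append_Nil split_list)
  have "gcycle E (bs @ as @ [x])"
    using assms(1) unfolding xs by (rule gcycle_swap)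
  then show ?thesis
    by (rule that) (auto simp: xs)
qed

lemma contains_copy_path_graph_iff:
  "contains_copy (V, E) (path_graph k) \<longleftrightarrow> (\<exists>xs. length xs = k \<and> set xs \<subseteq> V \<and> gpath E xs)"
proof
  assume "contains_copy (V, E) (path_graph k)"
  then obtain f where f: "inj_on f {..<k}" "f ` {..<k} \<subseteq> V"
      "\<forall>e\<in>{{i, Suc i} |i. Suc i < k}. f ` e \<in> E"
    unfolding contains_copy_def path_graph_def fst_conv snd_conv by blast
  have "{f i, f (Suc i)} \<in> E" if "Suc i < k" for i
    using f(3)[rule_format, of "{i, Suc i}"] that by auto
  then have "gpath E (map f [0..<k])"
    using f(1) by (auto simp: gpath_def distinct_map successively_conv_nth atLeast0LessThan)
  then show "\<exists>xs. length xs = k \<and> set xs \<subseteq> V \<and> gpath E xs"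
    using f(2) by (intro exI[of _ "map f [0..<k]"]) (auto simp: atLeast0LessThan)
next
  assume "\<exists>xs. length xs = k \<and> set xs \<subseteq> V \<and> gpath E xs"
  then obtain xs where xs: "length xs = k" "set xs \<subseteq> V" "gpath E xs"
    by blast
  then show "contains_copy (V, E) (path_graph k)"
    unfolding contains_copy_def path_graph_def
    by (intro exI[of _ "(!) xs"])
       (auto simp: gpath_def successively_conv_nth intro: inj_on_nth)
qed

lemma edges_complete_graph: "edges (complete_graph n) = {e. e \<subseteq> {..<n} \<and> card e = 2}"
  by (auto simp: complete_graph_def card_2_iff)

lemma verts_complete_graph [simp]: "verts (complete_graph n) = {..<n}"
  by (simp add: complete_graph_def)

lemma finite_edges_complete_graph: "finite (edges (complete_graph n))"
  by (simp add: edges_complete_graph)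

section \<open>The number of edges of a graph without long paths\<close>

text \<open>The crossing-chords argument of Dirac and Ore: if the first vertex is adjacent to
  \<open>xs ! Suc i\<close> and the last one to \<open>xs ! i\<close>, dropping the path edge
  between these two yields a cycle. Such an \<open>i\<close> exists by pigeonhole.\<close>

lemma path_closes_to_cycle:
  assumes path: "gpath E xs" and ne: "xs \<noteq> []"
    and hd_nbrs: "{u. {hd xs, u} \<in> E} \<subseteq> set xs - {hd xs}"
    and last_nbrs: "{u. {last xs, u} \<in> E} \<subseteq> set xs - {last xs}"
    and deg: "length xs \<le> card {u. {hd xs, u} \<in> E} + card {u. {last xs, u} \<in> E}"
  obtains ys where "gcycle E ys" "set ys = set xs" "length ys = length xs"
proof -
  define m where "m = length xs"
  have dist: "distinct xs" using path by (simp add: gpath_def)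
  have m: "m > 0" using ne by (simp add: m_def)
  \<comment> \<open>Neighbours of the first vertex are indexed by their predecessor on the path, so
    that \<open>A\<close> and \<open>B\<close> both index path edges, of which there are only
    \<open>m - 1\<close>.\<close>
  define A where "A = {i. Suc i < m \<and> {hd xs, xs ! Suc i} \<in> E}"
  define B where "B = {i. Suc i < m \<and> {last xs, xs ! i} \<in> E}"
  have fin: "finite A" "finite B"
    by (auto simp: A_def B_def intro: finite_subset[of _ "{..<m}"])
  have "{u. {hd xs, u} \<in> E} \<subseteq> (\<lambda>i. xs ! Suc i) ` A"
  proof
    fix u assume u: "u \<in> {u. {hd xs, u} \<in> E}"
    then have "u \<in> set xs" "u \<noteq> hd xs" using hd_nbrs by auto
    then obtain j where j: "j < m" "u = xs ! j" by (auto simp: in_set_conv_nth m_def)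
    with \<open>u \<noteq> hd xs\<close> ne have "j \<noteq> 0" by (metis hd_conv_nth)
    then obtain i where "j = Suc i" using not0_implies_Suc by blast
    with j u show "u \<in> (\<lambda>i. xs ! Suc i) ` A" by (auto simp: A_def)
  qed
  then have cA: "card {u. {hd xs, u} \<in> E} \<le> card A"
    using fin(1) surj_card_le by blast
  have "{u. {last xs, u} \<in> E} \<subseteq> (!) xs ` B"
  proof
    fix u assume u: "u \<in> {u. {last xs, u} \<in> E}"
    then have "u \<in> set xs" "u \<noteq> last xs" using last_nbrs by auto
    then obtain j where j: "j < m" "u = xs ! j" by (auto simp: in_set_conv_nth m_def)
    with \<open>u \<noteq> last xs\<close> ne have "j \<noteq> m - 1" by (metis last_conv_nth m_def)
    with j u show "u \<in> (!) xs ` B" by (auto simp: B_def)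
  qed
  then have cB: "card {u. {last xs, u} \<in> E} \<le> card B"
    using fin(2) surj_card_le by blast
  have "A \<inter> B \<noteq> {}"
  proof
    assume "A \<inter> B = {}"
    then have "card A + card B = card (A \<union> B)"
      using fin by (simp add: card_Un_disjoint)
    also have "\<dots> \<le> card {..<m - 1}"
      by (intro card_mono) (auto simp: A_def B_def)
    finally show False using cA cB deg[folded m_def] m by simp
  qed
  then obtain i where i: "Suc i < m" "{hd xs, xs ! Suc i} \<in> E" "{last xs, xs ! i} \<in> E"
    by (auto simp: A_def B_def)
  define as bs where "as = take (Suc i) xs" and "bs = drop (Suc i) xs"
  have xs: "xs = as @ bs" and ne': "as \<noteq> []" "bs \<noteq> []"
    using i(1) by (auto simp: as_def bs_def m_def)
  have "last as = xs ! i"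
    using i(1) by (simp add: as_def m_def take_Suc_conv_app_nth)
  moreover have "hd bs = xs ! Suc i" "hd as = hd xs" "last bs = last xs"
    using i(1) by (simp_all add: as_def bs_def m_def hd_drop_conv_nth hd_take)
  ultimately have ends: "last as = xs ! i" "hd bs = xs ! Suc i" "hd as = hd xs" "last bs = last xs"
    by auto
  \<comment> \<open>The route: forward to \<open>xs ! i\<close>, across to the last vertex, backward
    to \<open>xs ! Suc i\<close>, and home to the first vertex.\<close>
  have "gcycle E (as @ rev bs)"
    unfolding gcycle_def gpath_append
  proof (intro conjI impI)
    show "gpath E as" "gpath E (rev bs)" "set as \<inter> set (rev bs) = {}"
      using path by (simp_all add: xs gpath_append)
    show "{last as, hd (rev bs)} \<in> E"
      using i(3) ends by (simp add: hd_rev insert_commute)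
    show "{last (as @ rev bs), hd (as @ rev bs)} \<in> E"
      using i(2) ends ne' by (simp add: last_rev insert_commute)
  qed (use ne' in simp)
  then show ?thesis
    by (rule that) (auto simp: xs)
qed

lemma card_edges_le_card_pairs:
  assumes "finite V" "E \<subseteq> {e. e \<subseteq> V \<and> card e = 2}"
  shows "2 * card E \<le> card V * (card V - 1)"
proof -
  have "card E \<le> card {e. e \<subseteq> V \<and> card e = 2}"
    using assms by (intro card_mono) auto
  also have "\<dots> = card V choose 2"
    using assms(1) by (rule n_subsets)
  finally show ?thesis
    by (simp add: choose_two)
qed

lemma card_edges_at_vertex_le:
  assumes "finite V" "E \<subseteq> {e. e \<subseteq> V \<and> card e = 2}"
  shows "card {e \<in> E. v \<in> e} \<le> card {u. {v, u} \<in> E}"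
proof -
  have fin: "finite {u. {v, u} \<in> E}"
    using assms by (auto intro: finite_subset[of _ V])
  have "{e \<in> E. v \<in> e} \<subseteq> (\<lambda>u. {v, u}) ` {u. {v, u} \<in> E}"
  proof
    fix e assume e: "e \<in> {e \<in> E. v \<in> e}"
    then have "card e = 2" using assms(2) by auto
    then obtain a b where "e = {a, b}" by (auto simp: card_2_iff)
    with e show "e \<in> (\<lambda>u. {v, u}) ` {u. {v, u} \<in> E}" by (auto simp: insert_commute)
  qed
  then show ?thesis
    using fin surj_card_le by blast
qed

text \<open>
  In the case of large minimum degree, a longest path closes up to a cycle; by maximality no edge
  leaves its vertex set, which can therefore be split off.
\<close>

lemma card_edges_path_free:
  assumes "finite V" "E \<subseteq> {e. e \<subseteq> V \<and> card e = 2}"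
    and "\<nexists>xs. length xs = k \<and> set xs \<subseteq> V \<and> gpath E xs"
  shows "2 * card E \<le> card V * (k - 1)"
  using assms
proof (induction "card V" arbitrary: V E rule: less_induct)
  case less
  note finV = less.prems(1) and EV = less.prems(2) and free = less.prems(3)
  have finE: "finite E"
    using finV EV by (auto intro: finite_subset[of _ "Pow V"])
  have short: "length xs < k" if "set xs \<subseteq> V" "gpath E xs" for xs
  proof (rule ccontr)
    assume "\<not> length xs < k"
    moreover have "gpath E (take k xs)"
      using that(2) gpath_append[of E "take k xs" "drop k xs"] by simp
    ultimately show False
      using free that(1) set_take_subset[of k xs] by (metis length_take min.absorb2 not_less subset_trans)
  qed
  \<comment> \<open>Deleting \<open>W\<close> is affordable if the edges meeting it number at most
    \<open>(k - 1) / 2\<close> per deleted vertex. It is applied to one vertex of low degree and to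
    the vertex set of a longest path.\<close>
  have split_off: "2 * card E \<le> card V * (k - 1)"
    if "W \<subseteq> V" "W \<noteq> {}" "2 * card {e \<in> E. e \<inter> W \<noteq> {}} \<le> card W * (k - 1)" for W
  proof -
    let ?E = "{e \<in> E. e \<inter> W = {}}"
    have cV: "card V = card W + card (V - W)"
      using that finV by (metis card_Diff_subset card_mono finite_subset le_add_diff_inverse)
    moreover have "card W > 0"
      using that finV by (meson card_gt_0_iff finite_subset)
    ultimately have lt: "card (V - W) < card V" by simp
    have "\<nexists>xs. length xs = k \<and> set xs \<subseteq> V - W \<and> gpath ?E xs"
      using free gpath_mono[of ?E _ E] by blast
    then have "2 * card ?E \<le> card (V - W) * (k - 1)"
      using less.hyps[OF lt, of ?E] finV EV by auto
    moreover have "E = ?E \<union> {e \<in> E. e \<inter> W \<noteq> {}}" by auto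
    then have "card E \<le> card ?E + card {e \<in> E. e \<inter> W \<noteq> {}}"
      by (metis (no_types, lifting) card_Un_le)
    ultimately show ?thesis
      using that(3) by (simp add: cV add_mult_distrib)
  qed
  show ?case
  proof (cases "V = {} \<or> (\<exists>v\<in>V. 2 * card {u. {v, u} \<in> E} \<le> k - 1)")
    case True
    show ?thesis
    proof (cases "V = {}")
      case True
      then have "E = {}" using EV by auto
      then show ?thesis by simp
    next
      case False
      with True obtain v where "v \<in> V" "2 * card {u. {v, u} \<in> E} \<le> k - 1" by auto
      then show ?thesis
        using card_edges_at_vertex_le[OF finV EV, of v] by (intro split_off[of "{v}"]) auto
    qed
  next
    case False
    then obtain v0 where v0: "v0 \<in> V" by auto
    let ?P = "\<lambda>xs. set xs \<subseteq> V \<and> gpath E xs"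
    have "?P [v0]" using v0 by (simp add: gpath_def)
    then obtain xs where xs: "?P xs" and longest: "\<And>ys. ?P ys \<Longrightarrow> length ys \<le> length xs"
      using ex_has_greatest_nat[of ?P "[v0]" length k] short by (metis less_imp_le)
    have ne: "xs \<noteq> []" using longest[OF \<open>?P [v0]\<close>] by auto
    have sym: "{u, v} \<in> E \<Longrightarrow> {v, u} \<in> E" for u v by (simp add: insert_commute)
    have adj: "u \<in> V \<and> v \<in> V \<and> u \<noteq> v" if "{u, v} \<in> E" for u v
      using that EV by (auto simp: card_2_iff doubleton_eq_iff)
    have hd_nbrs: "{u. {hd xs, u} \<in> E} \<subseteq> set xs - {hd xs}"
    proof
      fix u assume u: "u \<in> {u. {hd xs, u} \<in> E}"
      have "\<not> ?P (u # xs)" using longest[of "u # xs"] by auto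
      with u xs adj[of "hd xs" u] sym show "u \<in> set xs - {hd xs}"
        by (auto simp: gpath_Cons)
    qed
    have last_nbrs: "{u. {last xs, u} \<in> E} \<subseteq> set xs - {last xs}"
    proof
      fix u assume u: "u \<in> {u. {last xs, u} \<in> E}"
      have "\<not> ?P (xs @ [u])" using longest[of "xs @ [u]"] by auto
      with u xs adj[of "last xs" u] show "u \<in> set xs - {last xs}"
        by (auto simp: gpath_def successively_append_iff)
    qed
    have len: "length xs < k" using short xs by blast
    have "hd xs \<in> V" "last xs \<in> V" using xs ne by auto
    with False have "k - 1 < 2 * card {u. {hd xs, u} \<in> E}" "k - 1 < 2 * card {u. {last xs, u} \<in> E}"
      by auto
    with len have "length xs \<le> card {u. {hd xs, u} \<in> E} + card {u. {last xs, u} \<in> E}"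
      by linarith
    then obtain ys where ys: "gcycle E ys" "set ys = set xs" "length ys = length xs"
      using path_closes_to_cycle[OF _ ne hd_nbrs last_nbrs] xs by blast
    \<comment> \<open>An edge from outside to \<open>v\<close> could be put in front of the cycle
      opened at \<open>v\<close>, giving a path longer than the longest one.\<close>
    have closed: "u \<in> set xs" if "v \<in> set xs" "{u, v} \<in> E" for u v
    proof (rule ccontr)
      assume u: "u \<notin> set xs"
      have "v \<in> set ys" using that(1) ys(2) by simp
      then obtain zs where zs: "gcycle E zs" "set zs = set ys" "length zs = length ys" "hd zs = v"
        using gcycle_start_at[OF ys(1)] by metis
      have "gpath E (u # zs)"
        unfolding gpath_Cons
      proof (intro conjI impI)
        show "u \<notin> set zs" using u zs(2) ys(2) by simp
        show "gpath E zs" using zs(1) by (simp add: gcycle_def)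
        show "{u, hd zs} \<in> E" using that(2) zs(4) by simp
      qed
      moreover have "set (u # zs) \<subseteq> V"
        using zs(2) ys(2) xs adj[OF that(2)] by simp
      ultimately have "?P (u # zs)" by blast
      then show False using longest[of "u # zs"] zs(3) ys(3) by simp
    qed
    have card_xs: "card (set xs) = length xs"
      using xs by (simp add: gpath_def distinct_card)
    have "{e \<in> E. e \<inter> set xs \<noteq> {}} \<subseteq> {e. e \<subseteq> set xs \<and> card e = 2}"
    proof
      fix e assume e: "e \<in> {e \<in> E. e \<inter> set xs \<noteq> {}}"
      then have "card e = 2" using EV by auto
      then obtain u v where "e = {u, v}" by (auto simp: card_2_iff)
      with e show "e \<in> {e. e \<subseteq> set xs \<and> card e = 2}"
        using closed[of u v] closed[of v u] \<open>card e = 2\<close> by (auto simp: insert_commute)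
    qed
    then have "2 * card {e \<in> E. e \<inter> set xs \<noteq> {}} \<le> card (set xs) * (card (set xs) - 1)"
      by (intro card_edges_le_card_pairs) auto
    also have "\<dots> \<le> card (set xs) * (k - 1)"
      using len card_xs by (intro mult_left_mono) auto
    finally show ?thesis
      using xs ne by (intro split_off[of "set xs"]) auto
  qed
qed

section \<open>The score is the size of a reachable position\<close>

text \<open>Every option of either player, a pass included, preserves \<open>Q\<close>, so every
  final position obeys the bound. \<open>Q\<close> is asked to follow from the legality of the last
  move alone, which suits freeness, a condition built into \<open>legal_moves\<close>.\<close>

lemma pass_value_le:
  assumes "finite (edges H)" "E \<subseteq> edges H" "Q E"
    and "\<And>E e. e \<in> legal_moves H \<F> E \<Longrightarrow> Q (insert e E)"
    and "\<And>E. E \<subseteq> edges H \<Longrightarrow> Q E \<Longrightarrow> card E \<le> b"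
  shows "pass_value H \<F> p E \<le> b"
  using assms
proof (induction H \<F> p E rule: pass_value.induct)
  case (1 H \<F> p E)
  note fin = "1.prems"(1)
  have finL: "finite (legal_moves H \<F> E)"
    using fin by (simp add: legal_moves_def)
  have step: "insert e E \<subseteq> edges H \<and> Q (insert e E)" if "e \<in> legal_moves H \<F> E" for e
    using that "1.prems" by (auto simp: legal_moves_def)
  show ?case
  proof (cases "legal_moves H \<F> E = {}")
    case True
    then show ?thesis
      using "1.prems" by (subst pass_value.simps) auto
  next
    case False
    note live = this fin
    show ?thesis
    proof (cases p)
      case Shortener
      obtain e where e: "e \<in> legal_moves H \<F> E" using False by blast
      have "pass_value H \<F> Prolonger (insert e E) \<le> b"
        using "1.IH"(3)[of e] e step[OF e] live Shortener "1.prems"(4,5) by simp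
      then show ?thesis
        using e finL live Shortener
        by (subst pass_value.simps) (auto simp: Min_le_iff)
    next
      case Prolonger
      have "pass_value H \<F> Shortener E \<le> b"
        using "1.IH"(1) live Prolonger "1.prems" by simp
      moreover have "pass_value H \<F> Shortener (insert e E) \<le> b" if "e \<in> legal_moves H \<F> E" for e
        using "1.IH"(2)[of e] that step[OF that] live Prolonger "1.prems"(4,5) by simp
      ultimately show ?thesis
        using finL live Prolonger
        by (subst pass_value.simps) auto
    qed
  qed
qed

lemma score_upper_bound:
  assumes "1 \<le> k"
  shows "2 * pass_game_score p (complete_graph n) {path_graph k} \<le> n * (k - 1)"
proof -
  let ?H = "complete_graph n"
  let ?Q = "\<lambda>E. E = {} \<or> family_free {path_graph k} (verts ?H, E)"
  have "pass_value ?H {path_graph k} p {} \<le> n * (k - 1) div 2"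
  proof (rule pass_value_le[where Q = ?Q])
    show "card E \<le> n * (k - 1) div 2" if "E \<subseteq> edges ?H" "?Q E" for E
    proof (cases "E = {}")
      case False
      with that(2) have "\<nexists>xs. length xs = k \<and> set xs \<subseteq> {..<n} \<and> gpath E xs"
        by (simp add: family_free_def contains_copy_path_graph_iff)
      then have "2 * card E \<le> card {..<n} * (k - 1)"
        using that(1) by (intro card_edges_path_free) (auto simp: edges_complete_graph)
      then show ?thesis by simp
    qed simp
  qed (auto simp: finite_edges_complete_graph legal_moves_def)
  then show ?thesis by (simp add: pass_game_score_def)
qed

text \<open>A strategy for Prolonger as an invariant of the positions with Shortener to move. In
  \<open>response\<close>, the first disjunct means that he passes and the second that he repairs
  \<open>Q\<close> by playing \<open>e'\<close>.\<close>

lemma pass_value_ge: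
  assumes fin: "finite (edges H)" and "E \<subseteq> edges H" "Q E"
    and response: "\<And>E e. \<lbrakk>E \<subseteq> edges H; Q E; e \<in> legal_moves H \<F> E\<rbrakk> \<Longrightarrow>
      Q (insert e E) \<or> (\<exists>e'\<in>legal_moves H \<F> (insert e E). Q (insert e' (insert e E)))"
    and final: "\<And>E. \<lbrakk>E \<subseteq> edges H; Q E; legal_moves H \<F> E = {}\<rbrakk> \<Longrightarrow> b \<le> card E"
  shows "b \<le> pass_value H \<F> p E"
proof -
  have finL: "finite (legal_moves H \<F> E)" for E
    using fin by (simp add: legal_moves_def)
  \<comment> \<open>Also covers Prolonger moving first: he passes at once.\<close>
  have pass: "b \<le> pass_value H \<F> Prolonger E"
    if "E \<subseteq> edges H" "Q E" "b \<le> pass_value H \<F> Shortener E" for E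
    using that fin finL final by (subst pass_value.simps) (auto simp: Max_ge_iff)
  have shortener: "b \<le> pass_value H \<F> Shortener E" if "E \<subseteq> edges H" "Q E" for E
    using that
  \<comment> \<open>One induction step is a whole round, since \<open>Q\<close> may fail between
    Shortener's move and the answer.\<close>
  proof (induction "card (edges H - E)" arbitrary: E rule: less_induct)
    case less
    have "b \<le> pass_value H \<F> Prolonger (insert e E)" if e: "e \<in> legal_moves H \<F> E" for e
    proof -
      have sub: "insert e E \<subseteq> edges H"
        using e less.prems by (auto simp: legal_moves_def)
      have lt: "card (edges H - insert e E) < card (edges H - E)"
        using card_legal_move_less[OF fin e] .
      show ?thesis
        using response[OF less.prems e]
      proof
        assume "Q (insert e E)"
        then show ?thesis
          using less.hyps[OF lt sub] pass sub by blast
      next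
        assume "\<exists>e'\<in>legal_moves H \<F> (insert e E). Q (insert e' (insert e E))"
        then obtain e' where e': "e' \<in> legal_moves H \<F> (insert e E)" "Q (insert e' (insert e E))"
          by blast
        have "b \<le> pass_value H \<F> Shortener (insert e' (insert e E))"
        proof (rule less.hyps)
          show "card (edges H - insert e' (insert e E)) < card (edges H - E)"
            using card_legal_move_less[OF fin e'(1)] lt by simp
          show "insert e' (insert e E) \<subseteq> edges H"
            using e'(1) sub by (auto simp: legal_moves_def)
        qed (rule e'(2))
        then show ?thesis
          using e'(1) fin finL by (subst pass_value.simps) (auto simp: Max_ge_iff le_max_iff_disj)
      qed
    qed
    then show ?case
      using less.prems fin finL final by (subst pass_value.simps) auto
  qed
  show ?thesis
    using assms(2,3) shortener pass by (cases p) auto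
qed

section \<open>Prolonger's strategy\<close>

text \<open>Since each part is spanned by a \<open>gcycle\<close> and no edge joins two parts,
  \<open>P\<close> consists of the connected components. A partition expresses this without a notion
  of connectivity.\<close>

definition cyclic_partition :: "'a set \<Rightarrow> nat \<Rightarrow> 'a set set \<Rightarrow> 'a set set \<Rightarrow> bool" where
  "cyclic_partition V k E P \<longleftrightarrow> partition_on V P \<and> (\<forall>e\<in>E. \<exists>A\<in>P. e \<subseteq> A) \<and>
     (\<forall>A\<in>P. card A < k \<and> (\<exists>xs. set xs = A \<and> gcycle E xs))"

lemma gpath_subset_part:
  assumes "partition_on V P" "\<forall>e\<in>E. \<exists>A\<in>P. e \<subseteq> A"
    and "gpath E xs" "xs \<noteq> []" "A \<in> P" "hd xs \<in> A"
  shows "set xs \<subseteq> A"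
  using assms(3-)
proof (induction xs)
  case (Cons x xs)
  show ?case
  proof (cases "xs = []")
    case False
    then have "{x, hd xs} \<in> E" using Cons.prems by (simp add: gpath_Cons)
    then obtain B where B: "B \<in> P" "x \<in> B" "hd xs \<in> B" using assms(2) by auto
    then have "B = A"
      using Cons.prems assms(1) by (auto simp: partition_on_def disjoint_def)
    then show ?thesis
      using Cons False B by (simp add: gpath_Cons)
  qed (use Cons.prems in auto)
qed simp

text \<open>A path stays in the part of its first vertex, which has too few vertices for it. This is
  the source of all legality claims: an edge may be added whenever the parts, possibly after a
  merge, stay smaller than \<open>k\<close>.\<close>

lemma path_free_if_small_parts:
  assumes "finite V" "partition_on V P" "\<forall>e\<in>E. \<exists>A\<in>P. e \<subseteq> A" "\<forall>A\<in>P. card A < k" "1 \<le> k"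
  shows "family_free {path_graph k} (V, E)"
proof -
  have False if xs: "length xs = k" "set xs \<subseteq> V" "gpath E xs" for xs
  proof -
    have "xs \<noteq> []" using xs \<open>1 \<le> k\<close> by auto
    then have "hd xs \<in> \<Union>P"
      using xs(2) assms(2) by (auto simp: partition_on_def)
    then obtain A where A: "A \<in> P" "hd xs \<in> A" by blast
    then have "set xs \<subseteq> A"
      using gpath_subset_part assms(2,3) xs(3) \<open>xs \<noteq> []\<close> by metis
    moreover have "finite A"
      using A(1) assms(1,2) by (metis finite_elements finite_subset partition_on_def Sup_upper)
    ultimately have "card (set xs) \<le> card A" by (rule card_mono[rotated])
    moreover have "card (set xs) = k"
      using xs by (simp add: gpath_def distinct_card)
    ultimately show False using A(1) assms(4) by auto
  qed
  then show ?thesis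
    by (auto simp: family_free_def contains_copy_path_graph_iff)
qed

lemma partition_on_merge:
  assumes "partition_on V P" "A \<in> P" "B \<in> P"
  shows "partition_on V (insert (A \<union> B) (P - {A, B}))"
proof -
  have cover: "\<Union>P = V" and disj: "\<And>C D. \<lbrakk>C \<in> P; D \<in> P; C \<noteq> D\<rbrakk> \<Longrightarrow> C \<inter> D = {}"
    and ne: "\<And>C. C \<in> P \<Longrightarrow> C \<noteq> {}"
    using assms(1) by (auto simp: partition_on_def disjoint_def)
  have merged: "(A \<union> B) \<inter> C = {}" if "C \<in> P - {A, B}" for C
    using disj[of A C] disj[of B C] that assms(2,3) by auto
  show ?thesis
    unfolding partition_on_def
  proof (intro conjI)
    show "\<Union>(insert (A \<union> B) (P - {A, B})) = V"
      using cover assms(2,3) by auto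
    show "disjoint (insert (A \<union> B) (P - {A, B}))"
    proof (rule disjointI)
      fix C D
      assume "C \<in> insert (A \<union> B) (P - {A, B})" "D \<in> insert (A \<union> B) (P - {A, B})" "C \<noteq> D"
      then consider "C = A \<union> B" "D \<in> P - {A, B}" | "D = A \<union> B" "C \<in> P - {A, B}"
        | "C \<in> P" "D \<in> P"
        by blast
      then show "C \<inter> D = {}"
        using merged disj \<open>C \<noteq> D\<close> by cases (simp_all add: Int_commute)
    qed
    show "{} \<notin> insert (A \<union> B) (P - {A, B})"
      using ne assms(2) by auto
  qed
qed

lemma subset_merged_part:
  assumes "\<exists>C\<in>P. f \<subseteq> C"
  shows "\<exists>C\<in>insert (A \<union> B) (P - {A, B}). f \<subseteq> C"
proof -
  obtain C where "C \<in> P" "f \<subseteq> C" using assms by blast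
  then show ?thesis by (cases "C \<in> {A, B}") auto
qed

text \<open>
  If Shortener joins two parts, their Hamiltonian cycles and her edge \<open>{x, y}\<close> form a Hamiltonian
  path of the union, so the union is small because her move was legal. Prolonger closes that path
  to a cycle; when both parts are singletons the closing edge is \<open>{x, y}\<close> itself and he passes.
\<close>

lemma cyclic_partition_response:
  assumes k: "2 \<le> k" and inv: "cyclic_partition {..<n} k E P"
    and e: "e \<in> legal_moves (complete_graph n) {path_graph k} E"
  shows "(\<exists>P. cyclic_partition {..<n} k (insert e E) P) \<or>
    (\<exists>e'\<in>legal_moves (complete_graph n) {path_graph k} (insert e E).
       \<exists>P. cyclic_partition {..<n} k (insert e' (insert e E)) P)"
proof -
  have part: "partition_on {..<n} P" and inE: "\<forall>e\<in>E. \<exists>A\<in>P. e \<subseteq> A"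
    and parts: "\<And>A. A \<in> P \<Longrightarrow> card A < k \<and> (\<exists>xs. set xs = A \<and> gcycle E xs)"
    using inv by (auto simp: cyclic_partition_def)
  have "e \<subseteq> {..<n}" "card e = 2"
    using e by (auto simp: legal_moves_def edges_complete_graph)
  then obtain x y where xy: "e = {x, y}" "x \<noteq> y" "x < n" "y < n"
    by (auto simp: card_2_iff)
  have "x \<in> \<Union>P" "y \<in> \<Union>P"
    using part xy by (auto simp: partition_on_def)
  then obtain A B where AB: "A \<in> P" "B \<in> P" "x \<in> A" "y \<in> B" by blast
  show ?thesis
  proof (cases "A = B")
    case True
    have "cyclic_partition {..<n} k (insert e E) P"
      unfolding cyclic_partition_def
    proof (intro conjI ballI)
      show "\<exists>A\<in>P. f \<subseteq> A" if "f \<in> insert e E" for f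
        using that inE AB xy True by blast
      show "\<exists>xs. set xs = C \<and> gcycle (insert e E) xs" if "C \<in> P" for C
        using parts[OF that] gcycle_mono[of E _ "insert e E"] by blast
    qed (use part parts in auto)
    then show ?thesis by blast
  next
    case False
    then have disj: "A \<inter> B = {}"
      using AB part by (auto simp: partition_on_def disjoint_def)
    \<comment> \<open>The two cycles are opened at the ends of Shortener's edge, so that
      \<open>ys @ zs\<close> runs across it.\<close>
    obtain ys where ys: "gcycle E ys" "set ys = A" "last ys = x"
      using parts[OF AB(1)] AB(3) gcycle_end_at by metis
    obtain zs where zs: "gcycle E zs" "set zs = B" "hd zs = y"
      using parts[OF AB(2)] AB(4) gcycle_start_at by metis
    have ne: "ys \<noteq> []" "zs \<noteq> []" using ys zs by (auto simp: gcycle_def)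
    have "gpath (insert e E) ys" "gpath (insert e E) zs"
      using ys zs by (auto simp: gcycle_def intro: gpath_mono)
    then have path: "gpath (insert e E) (ys @ zs)"
      using ys zs disj xy by (auto simp: gpath_append)
    have sub_n: "A \<union> B \<subseteq> {..<n}"
      using AB part by (auto simp: partition_on_def)
    have "card A + card B = card (A \<union> B)"
      using disj sub_n by (metis card_Un_disjoint finite_Un finite_lessThan finite_subset)
    have small: "card (A \<union> B) < k"
    proof (rule ccontr)
      assume "\<not> card (A \<union> B) < k"
      moreover have "card (A \<union> B) = length (ys @ zs)"
        using path ys(2) zs(2) distinct_card[of "ys @ zs"] by (simp add: gpath_def)
      ultimately have len: "length (take k (ys @ zs)) = k" by simp
      have "gpath (insert e E) (take k (ys @ zs))"
        using path gpath_append[of "insert e E" "take k (ys @ zs)" "drop k (ys @ zs)"]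
        by (simp del: take_append drop_append)
      moreover have "set (take k (ys @ zs)) \<subseteq> {..<n}"
        using sub_n ys(2) zs(2) set_take_subset[of k "ys @ zs"] by fastforce
      ultimately have "contains_copy ({..<n}, insert e E) (path_graph k)"
        using len contains_copy_path_graph_iff by blast
      then show False
        using e by (simp add: legal_moves_def family_free_def)
    qed
    define e' where "e' = {last zs, hd ys}"
    define E' where "E' = insert e' (insert e E)"
    define P' where "P' = insert (A \<union> B) (P - {A, B})"
    have part': "partition_on {..<n} P'"
      unfolding P'_def using partition_on_merge part AB by blast
    have e'AB: "e' \<subseteq> A \<union> B"
      using ne ys(2) zs(2) by (auto simp: e'_def)
    have inE': "\<forall>f\<in>E'. \<exists>A\<in>P'. f \<subseteq> A"
    proof
      fix f assume "f \<in> E'"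
      then consider "f \<subseteq> A \<union> B" | "f \<in> E"
        using e'AB xy AB by (auto simp: E'_def)
      then show "\<exists>A\<in>P'. f \<subseteq> A"
        unfolding P'_def by cases (simp, intro subset_merged_part inE[rule_format])
    qed
    have smallP': "\<forall>C\<in>P'. card C < k"
      using small parts by (auto simp: P'_def)
    have inv': "cyclic_partition {..<n} k E' P'"
      unfolding cyclic_partition_def
    proof (intro conjI ballI part' inE'[rule_format])
      show "\<exists>xs. set xs = C \<and> gcycle E' xs" if "C \<in> P'" for C
      proof (cases "C = A \<union> B")
        case True
        have "gcycle E' (ys @ zs)"
          using gpath_mono[OF path, of E'] ne by (auto simp: gcycle_def E'_def e'_def)
        then show ?thesis using ys zs True by (metis set_append)
      next
        case False
        then have "C \<in> P" using that by (auto simp: P'_def)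
        then show ?thesis
          using parts[of C] gcycle_mono[of E _ E'] by (auto simp: E'_def)
      qed
    qed (use smallP' in auto)
    show ?thesis
    proof (cases "e' \<in> insert e E")
      case True
      then have "E' = insert e E" by (auto simp: E'_def)
      then show ?thesis using inv' by auto
    next
      case False
      have "last zs \<in> B" "hd ys \<in> A" using ne ys zs by auto
      then have "last zs \<noteq> hd ys" "e' \<subseteq> {..<n}"
        using sub_n disj by (auto simp: e'_def)
      then have "e' \<in> edges (complete_graph n)"
        by (simp add: e'_def edges_complete_graph)
      moreover have "family_free {path_graph k} ({..<n}, E')"
        using path_free_if_small_parts part' inE' smallP' k by (metis finite_lessThan one_le_numeral order_trans)
      ultimately have "e' \<in> legal_moves (complete_graph n) {path_graph k} (insert e E)"
        using False by (simp add: legal_moves_def E'_def)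
      then show ?thesis using inv' by (auto simp: E'_def)
    qed
  qed
qed

section \<open>Counting edges at the end of the game\<close>

text \<open>A part with at least k/2 vertices satisfies the inequality by itself. By
  \<open>pair\<close> at most one part is smaller; it is compensated by any other part.\<close>

lemma sum_parts_bound:
  fixes c :: "'b \<Rightarrow> nat"
  assumes fin: "finite P" and total: "k \<le> sum c P" and small: "\<And>A. A \<in> P \<Longrightarrow> c A < k"
    and pair: "\<And>A B. \<lbrakk>A \<in> P; B \<in> P; A \<noteq> B\<rbrakk> \<Longrightarrow> k \<le> c A + c B"
  shows "real (sum c P) * (real k - 2) \<le> (\<Sum>A\<in>P. 2 * real (c A) * (real (c A) - 1))"
proof -
  have large: "real (c A) * (real k - 2) \<le> 2 * real (c A) * (real (c A) - 1)" if "k \<le> 2 * c A" for A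
  proof -
    have "real k \<le> 2 * real (c A)" using that by linarith
    then have "real (c A) * (real k - 2) \<le> real (c A) * (2 * (real (c A) - 1))"
      by (intro mult_left_mono) auto
    then show ?thesis by (simp add: algebra_simps)
  qed
  have "(\<Sum>A\<in>P. real (c A) * (real k - 2)) \<le> (\<Sum>A\<in>P. 2 * real (c A) * (real (c A) - 1))"
  proof (cases "\<forall>A\<in>P. k \<le> 2 * c A")
    case True
    then show ?thesis by (intro sum_mono large) auto
  next
    case False
    then obtain A where A: "A \<in> P" "2 * c A < k" by auto
    \<comment> \<open>The total is at least \<open>k\<close> while \<open>c A < k\<close>, so a
      partner for the small part exists.\<close>
    have "P \<noteq> {A}" using total small[OF A(1)] by auto
    then obtain B where B: "B \<in> P" "B \<noteq> A" using A(1) by blast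
    define R where "R = P - {A, B}"
    have P: "P = insert A (insert B R)" and R: "A \<notin> insert B R" "B \<notin> R" "finite R"
      using A B fin by (auto simp: R_def)
    have "(\<Sum>C\<in>R. real (c C) * (real k - 2)) \<le> (\<Sum>C\<in>R. 2 * real (c C) * (real (c C) - 1))"
    proof (intro sum_mono large)
      fix C assume "C \<in> R"
      then show "k \<le> 2 * c C" using pair[of A C] A by (auto simp: R_def)
    qed
    moreover have "real (c A) * (real k - 2) + real (c B) * (real k - 2)
        \<le> 2 * real (c A) * (real (c A) - 1) + 2 * real (c B) * (real (c B) - 1)"
    proof -
      \<comment> \<open>The identity 2a(a - 1) + 2b(b - 1) = (a + b)^2 + (a - b)^2 - 2(a + b),
        combined with a + b >= k.\<close>
      let ?a = "real (c A)" and ?b = "real (c B)"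
      have "(?a + ?b) * real k \<le> (?a + ?b) * (?a + ?b)"
        using pair[of A B] A B by (intro mult_left_mono) auto
      also have "\<dots> \<le> (?a + ?b) * (?a + ?b) + (?a - ?b)\<^sup>2" by simp
      finally show ?thesis by (simp add: algebra_simps power2_eq_square)
    qed
    ultimately show ?thesis
      using R by (simp add: P)
  qed
  then show ?thesis by (simp add: sum_distrib_right)
qed

lemma cyclic_partition_final:
  assumes k: "2 \<le> k" "k \<le> n" and inv: "cyclic_partition {..<n} k E P"
    and sub: "E \<subseteq> edges (complete_graph n)"
    and final: "legal_moves (complete_graph n) {path_graph k} E = {}"
  shows "real n * (real k - 2) \<le> 4 * real (card E)"
proof -
  have part: "partition_on {..<n} P" and inE: "\<forall>e\<in>E. \<exists>A\<in>P. e \<subseteq> A"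
    and small: "\<And>A. A \<in> P \<Longrightarrow> card A < k"
    using inv by (auto simp: cyclic_partition_def)
  have disj: "A \<inter> B = {}" if "A \<in> P" "B \<in> P" "A \<noteq> B" for A B
    using that part by (auto simp: partition_on_def disjoint_def)
  have sub_n: "A \<subseteq> {..<n}" "finite A" if "A \<in> P" for A
    using that part finite_subset[of A "{..<n}"] by (auto simp: partition_on_def)
  have finP: "finite P"
    using part by (rule finite_elements[rotated]) simp
  have finE: "finite E"
    using sub finite_edges_complete_graph finite_subset by blast
  \<comment> \<open>Stated for an arbitrary partition \<open>P'\<close>: with \<open>P\<close>
    itself it makes the parts cliques, with two parts merged it shows that their orders sum to at
    least \<open>k\<close>.\<close>
  have present: "e \<in> E"
    if "e \<subseteq> {..<n}" "card e = 2" "partition_on {..<n} P'" "\<forall>f\<in>insert e E. \<exists>A\<in>P'. f \<subseteq> A"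
      "\<forall>A\<in>P'. card A < k" for e P'
  proof (rule ccontr)
    assume "e \<notin> E"
    moreover have "family_free {path_graph k} ({..<n}, insert e E)"
      using that k by (intro path_free_if_small_parts) auto
    ultimately have "e \<in> legal_moves (complete_graph n) {path_graph k} E"
      using that by (simp add: legal_moves_def edges_complete_graph)
    then show False using final by simp
  qed
  have clique: "{e. e \<subseteq> A \<and> card e = 2} \<subseteq> E" if "A \<in> P" for A
  proof
    fix e assume e: "e \<in> {e. e \<subseteq> A \<and> card e = 2}"
    have "e \<subseteq> {..<n}" using e sub_n(1)[OF that] by blast
    then show "e \<in> E"
      by (rule present[of e P]) (use e that part inE small in auto)
  qed
  have pair: "k \<le> card A + card B" if AB: "A \<in> P" "B \<in> P" "A \<noteq> B" for A B
  proof (rule ccontr)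
    assume "\<not> k \<le> card A + card B"
    then have lt: "card (A \<union> B) < k" using card_Un_le[of A B] by linarith
    have "A \<noteq> {}" "B \<noteq> {}" using AB part by (auto simp: partition_on_def)
    then obtain x y where xy: "x \<in> A" "y \<in> B" by blast
    then have "x \<noteq> y" using disj[OF AB] by auto
    have "{x, y} \<in> E"
    proof (rule present)
      show "partition_on {..<n} (insert (A \<union> B) (P - {A, B}))"
        using part AB by (intro partition_on_merge) auto
      show "\<forall>f\<in>insert {x, y} E. \<exists>C\<in>insert (A \<union> B) (P - {A, B}). f \<subseteq> C"
      proof
        fix f assume "f \<in> insert {x, y} E"
        then consider "f \<subseteq> A \<union> B" | "f \<in> E" using xy by auto
        then show "\<exists>C\<in>insert (A \<union> B) (P - {A, B}). f \<subseteq> C"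
          by cases (simp, intro subset_merged_part inE[rule_format])
      qed
    qed (use lt small sub_n AB xy \<open>x \<noteq> y\<close> in auto)
    then obtain C where "C \<in> P" "x \<in> C" "y \<in> C" using inE by auto
    then show False using disj AB xy by blast
  qed
  have n: "n = (\<Sum>A\<in>P. card A)"
    using product_partition[of "{..<n}" P] part sub_n
    by (simp add: partition_on_def)
  have "(\<Sum>A\<in>P. card A choose 2) = (\<Sum>A\<in>P. card {e. e \<subseteq> A \<and> card e = 2})"
    using sub_n by (intro sum.cong) (auto simp: n_subsets)
  also have "\<dots> = card (\<Union>A\<in>P. {e. e \<subseteq> A \<and> card e = 2})"
  proof (intro card_UN_disjoint[symmetric] finP ballI impI)
    show "finite {e. e \<subseteq> A \<and> card e = 2}" if "A \<in> P" for A
      using sub_n(2)[OF that] by simp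
    show "{e. e \<subseteq> A \<and> card e = 2} \<inter> {e. e \<subseteq> B \<and> card e = 2} = {}"
      if "A \<in> P" "B \<in> P" "A \<noteq> B" for A B
    proof (rule equals0I)
      fix e assume e: "e \<in> {e. e \<subseteq> A \<and> card e = 2} \<inter> {e. e \<subseteq> B \<and> card e = 2}"
      then have "e \<subseteq> A \<inter> B" by blast
      then have "e = {}" using disj[OF that] by simp
      then show False using e by simp
    qed
  qed
  also have "\<dots> \<le> card E"
    using clique by (intro card_mono finE) blast
  finally have "(\<Sum>A\<in>P. real (card A choose 2)) \<le> real (card E)"
    by (simp flip: of_nat_sum)
  moreover have choose: "4 * real (m choose 2) = 2 * real m * (real m - 1)" for m
  proof -
    \<comment> \<open>\<open>choose_two\<close> divides in the naturals, so exactness has to be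
      established before passing to reals.\<close>
    have "even (m * (m - 1))" by (cases m) auto
    then have "2 * (m choose 2) = m * (m - 1)"
      unfolding choose_two by (rule dvd_mult_div_cancel)
    then have "2 * real (m choose 2) = real m * real (m - 1)"
      by (metis of_nat_mult of_nat_numeral)
    then show ?thesis by (cases m) (auto simp: algebra_simps)
  qed
  ultimately have "(\<Sum>A\<in>P. 2 * real (card A) * (real (card A) - 1)) \<le> 4 * real (card E)"
    by (simp only: choose[symmetric] sum_distrib_left[symmetric])
  moreover have "real (\<Sum>A\<in>P. card A) * (real k - 2)
      \<le> (\<Sum>A\<in>P. 2 * real (card A) * (real (card A) - 1))"
    using k n finP small pair by (intro sum_parts_bound) auto
  ultimately show ?thesis using n by simp
qed

lemma cyclic_partition_singletons:
  assumes "2 \<le> k"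
  shows "cyclic_partition V k {} ((\<lambda>v. {v}) ` V)"
proof -
  have "gcycle {} [v]" for v :: 'a
    by (simp add: gcycle_def gpath_def)
  then have "\<exists>xs. set xs = {v} \<and> gcycle {} xs" for v :: 'a
    by (intro exI[of _ "[v]"]) simp
  then show ?thesis
    using assms by (auto simp: cyclic_partition_def partition_on_def disjoint_def)
qed

lemma score_lower_bound:
  assumes "2 \<le> k" "k \<le> n"
  shows "real n * (real k - 2) \<le> 4 * real (pass_game_score p (complete_graph n) {path_graph k})"
proof -
  \<comment> \<open>The minimax lemma takes a natural bound, and scores are integers, so rounding up
    loses nothing.\<close>
  have "nat \<lceil>real n * (real k - 2) / 4\<rceil> \<le> pass_value (complete_graph n) {path_graph k} p {}"
  proof (rule pass_value_ge[where Q = "\<lambda>E. \<exists>P. cyclic_partition {..<n} k E P"])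
    show "nat \<lceil>real n * (real k - 2) / 4\<rceil> \<le> card E"
      if "E \<subseteq> edges (complete_graph n)" "\<exists>P. cyclic_partition {..<n} k E P"
        "legal_moves (complete_graph n) {path_graph k} E = {}" for E
    proof -
      have "real n * (real k - 2) \<le> 4 * real (card E)"
        using that cyclic_partition_final[OF assms] by blast
      then show ?thesis by (simp add: nat_le_iff ceiling_le_iff)
    qed
  qed (use assms cyclic_partition_singletons cyclic_partition_response finite_edges_complete_graph in blast)+
  then have "real n * (real k - 2) / 4 \<le> pass_value (complete_graph n) {path_graph k} p {}"
    by (simp add: nat_le_iff ceiling_le_iff)
  then show ?thesis by (simp add: pass_game_score_def)
qed

theorem theorem1:
  fixes n k :: nat and p :: player
  assumes "1 \<le> k" and "k \<le> n"
  shows "1 / 4 * real n * (real k - 2) \<le> real (pass_game_score p (complete_graph n) {path_graph k})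
       \<and> real (pass_game_score p (complete_graph n) {path_graph k}) \<le> 1 / 2 * real n * (real k - 1)"
proof
  let ?s = "pass_game_score p (complete_graph n) {path_graph k}"
  show "1 / 4 * real n * (real k - 2) \<le> real ?s"
  \<comment> \<open>For \<open>k = 1\<close> the strategy cannot start, as singletons already have
    order \<open>k\<close>, but the claimed bound is then at most 0.\<close>
  proof (cases "k = 1")
    case True
    have "1 / 4 * real n * (real k - 2) \<le> 0" using True by simp
    then show ?thesis by linarith
  next
    case False
    then show ?thesis using assms score_lower_bound[of k n p] by simp
  qed
  have "real (2 * ?s) \<le> real (n * (k - 1))"
    using score_upper_bound[OF assms(1)] of_nat_le_iff by blast
  then show "real ?s \<le> 1 / 2 * real n * (real k - 1)"
    using assms(1) by (simp add: of_nat_diff)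
qed

end
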